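(* Let $G$ be a finite simple graph with $n$ vertices and $m$ edges, where $m>0$. Then for every $\alpha\in[0,1]$, $$\lambda_{\min}(A_\alpha)\le \frac{2m}{n}\cdot\frac{\vartheta(\overline{G})\,\alpha-1}{\vartheta(\overline{G})-1},$$ and therefore $$\alpha_0(G)\ge \frac{1}{\vartheta(\overline{G})}.$$
   Context: For a simple graph $G$, $A=A(G)$ is its adjacency matrix, $D=D(G)$ is the diagonal matrix of vertex degrees, and $A_\alpha:=\alpha D+(1-\alpha)A$ for $\alpha\in[0,1]$. $\lambda_{\min}$ denotes the smallest eigenvalue. $M\succcurlyeq 0$ means $M$ is (symmetric) positive semidefinite. The parameter $\alpha_0=\alpha_0(G)$ is $$\alpha_0=\min\{\alpha\in\mathbb{R},\ \alpha\ge 0:\ \alpha D+(1-\alpha)A\succcurlyeq 0\},$$ equivalently the smallest nonnegative real such that $\alpha D+(1-\alpha)A\succcurlyeq 0$ for all $\alpha\ge\alpha_0$. $\overline{G}$ is the complement graph of $G$. The Lovász theta number of a graph $H$ on $n$ vertices is $$\vartheta(H)=\max\{\langle X,J\rangle:\ X\circ A(H)=0,\ \langle X,I\rangle=1,\ X\succcurlyeq 0\}=\min\{\lambda:\ \lambda I+Z-J\succcurlyeq 0,\ Z\circ(I+A(\overline{H}))=0\},$$ where $X,Z$ range over real symmetric $n\times n$ matrices, $\lambda\in\mathbb{R}$, $J$ is the all-ones matrix, $I$ the identity, $\circ$ the entrywise product, and $\langle M,N\rangle=\operatorname{tr}(M^TN)$. *)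

theory Defs
  imports "HOL-Analysis.Analysis"
begin

text \<open>
  A finite simple graph has the finite type \<open>'v\<close> as its vertex set, so that its order is
  \<open>CARD('v)\<close>, and is given by its set \<open>E\<close> of edges, which are two-element sets of vertices.
\<close>

definition simple_graph :: "'v::finite set set \<Rightarrow> bool" where
  "simple_graph E \<longleftrightarrow> (\<forall>e\<in>E. card e = 2)"

definition complement_graph :: "'v::finite set set \<Rightarrow> 'v set set" where
  "complement_graph E = {e. card e = 2 \<and> e \<notin> E}"

definition vertex_degree :: "'v::finite set set \<Rightarrow> 'v \<Rightarrow> nat" where
  "vertex_degree E v = card {e \<in> E. v \<in> e}"

text \<open>On the diagonal \<open>{i, j}\<close> is a singleton and hence not an edge of a simple graph.\<close>

definition adjacency_matrix :: "'v::finite set set \<Rightarrow> real^'v^'v" where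
  "adjacency_matrix E = (\<chi> i j. if {i, j} \<in> E then 1 else 0)"

definition degree_matrix :: "'v::finite set set \<Rightarrow> real^'v^'v" where
  "degree_matrix E = (\<chi> i j. if i = j then real (vertex_degree E i) else 0)"

definition A_alpha :: "'v::finite set set \<Rightarrow> real \<Rightarrow> real^'v^'v" where
  "A_alpha E \<alpha> = \<alpha> *\<^sub>R degree_matrix E + (1 - \<alpha>) *\<^sub>R adjacency_matrix E"

definition eigenvalue :: "real^'n^'n \<Rightarrow> real \<Rightarrow> bool" where
  "eigenvalue M c \<longleftrightarrow> (\<exists>x. x \<noteq> 0 \<and> M *v x = c *\<^sub>R x)"

text \<open>
  The set below is finite for every \<open>M\<close>, and nonempty when \<open>M\<close> is symmetric.
\<close>

definition lambda_min :: "real^'n^'n \<Rightarrow> real" where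
  "lambda_min M = Min {c. eigenvalue M c}"

definition psd :: "real^'n^'n \<Rightarrow> bool" where
  "psd M \<longleftrightarrow> transpose M = M \<and> (\<forall>x. 0 \<le> x \<bullet> (M *v x))"

definition trace_inner :: "real^'n^'n \<Rightarrow> real^'n^'n \<Rightarrow> real" where
  "trace_inner M N = trace (transpose M ** N)"

definition all_ones :: "real^'n^'n" where
  "all_ones = (\<chi> i j. 1)"

text \<open>
  The operator \<open>*\<close> on \<open>real^'n^'n\<close> is the entrywise product (the matrix product is \<open>**\<close>),
  and \<open>mat 1\<close> is the identity matrix.
\<close>

definition theta_feasible :: "'v::finite set set \<Rightarrow> (real^'v^'v) set" where
  "theta_feasible E = {X. X * adjacency_matrix E = 0 \<and> trace_inner X (mat 1) = 1 \<and> psd X}"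

text \<open>
  The supremum and the infimum below are a maximum and a minimum; see
  \<open>lovasz_theta_attained\<close> and \<open>alpha0_attained\<close>.
\<close>

definition lovasz_theta :: "'v::finite set set \<Rightarrow> real" where
  "lovasz_theta E = (SUP X\<in>theta_feasible E. trace_inner X all_ones)"

definition alpha0 :: "'v::finite set set \<Rightarrow> real" where
  "alpha0 E = Inf {\<alpha>. 0 \<le> \<alpha> \<and> psd (A_alpha E \<alpha>)}"

lemma trace_inner_eq_inner: "trace_inner M N = M \<bullet> N"
proof -
  have "trace_inner M N = (\<Sum>i\<in>UNIV. \<Sum>k\<in>UNIV. M $ k $ i * N $ k $ i)"
    by (simp add: trace_inner_def trace_def transpose_def matrix_matrix_mult_def)
  also have "\<dots> = M \<bullet> N"
    unfolding inner_vec_def inner_real_def by (rule sum.swap)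
  finally show ?thesis .
qed

lemma closed_psd: "closed {M :: real^'n^'n. psd M}"
proof -
  have eq: "{M :: real^'n^'n. psd M} =
      (\<Inter>i. \<Inter>j. {M. M $ i $ j = M $ j $ i}) \<inter> (\<Inter>x. {M. 0 \<le> x \<bullet> (M *v x)})"
    unfolding psd_def transpose_def vec_eq_iff vec_lambda_beta by blast
  have "closed {M :: real^'n^'n. M $ i $ j = M $ j $ i}" for i j
    by (intro closed_Collect_eq continuous_intros)
  moreover have "closed {M :: real^'n^'n. 0 \<le> x \<bullet> (M *v x)}" for x
    unfolding matrix_vector_mult_def inner_vec_def vec_lambda_beta inner_real_def
    by (intro closed_Collect_le continuous_intros)
  ultimately show ?thesis unfolding eq by blast
qed

lemma inner_matrix_axes: "axis i 1 \<bullet> (M *v axis j 1) = (M :: real^'n^'n) $ i $ j"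
  by (simp add: matrix_vector_mult_basis inner_axis' column_def)

lemma psd_diag_nonneg: "psd M \<Longrightarrow> 0 \<le> M $ i $ i"
  unfolding psd_def by (metis inner_matrix_axes)

lemma psd_entry_bound:
  assumes "psd M" shows "2 * \<bar>M $ i $ j\<bar> \<le> M $ i $ i + M $ j $ j"
proof -
  have "M $ j $ i = transpose M $ i $ j"
    by (simp add: transpose_def)
  then have sym: "M $ j $ i = M $ i $ j"
    using assms by (simp add: psd_def)
  have nonneg: "0 \<le> x \<bullet> (M *v x)" for x
    using assms by (simp add: psd_def)
  show ?thesis
    using nonneg[of "axis i 1 + axis j 1"] nonneg[of "axis i 1 - axis j 1"] sym
    by (simp add: matrix_vector_right_distrib matrix_vector_mult_diff_distrib inner_add_left
        inner_add_right inner_diff_left inner_diff_right inner_matrix_axes)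
qed

lemma compact_theta_feasible: "compact (theta_feasible E)" for E :: "'v::finite set set"
proof -
  have eq: "theta_feasible E =
      (\<Inter>i. \<Inter>j. {X. X $ i $ j * adjacency_matrix E $ i $ j = 0})
      \<inter> {X. X \<bullet> mat 1 = 1} \<inter> {X. psd X}"
    by (auto simp: theta_feasible_def trace_inner_eq_inner vec_eq_iff)
  moreover have "closed {X :: real^'v^'v. X $ i $ j * adjacency_matrix E $ i $ j = 0}" for i j
    by (intro closed_Collect_eq continuous_intros)
  moreover have "closed {X :: real^'v^'v. X \<bullet> mat 1 = 1}"
    by (intro closed_Collect_eq continuous_intros)
  ultimately have "closed (theta_feasible E)"
    unfolding eq by (intro closed_Int closed_INT ballI closed_psd)
  moreover have "bounded (theta_feasible E)"
  proof -
    have entry: "\<bar>X $ i $ j\<bar> \<le> 1" if "X \<in> theta_feasible E" for X i j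
    proof -
      have X: "psd X" and tr: "(\<Sum>k\<in>UNIV. X $ k $ k) = 1"
        using that by (auto simp: theta_feasible_def trace_inner_def trace_def transpose_def)
      have "X $ k $ k \<le> 1" for k
        using psd_diag_nonneg[OF X] member_le_sum[of k UNIV "\<lambda>k. X $ k $ k"] tr by auto
      from this[of i] this[of j] psd_entry_bound[OF X, of i j] show ?thesis by linarith
    qed
    have "norm X \<le> (\<Sum>i\<in>(UNIV::'v set). \<Sum>j\<in>(UNIV::'v set). 1)"
      if "X \<in> theta_feasible E" for X
    proof -
      have "norm X \<le> (\<Sum>i\<in>UNIV. norm (X $ i))"
        unfolding norm_vec_def by (rule L2_set_le_sum) simp
      also have "\<dots> \<le> (\<Sum>i\<in>UNIV. \<Sum>j\<in>UNIV. \<bar>X $ i $ j\<bar>)"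
        by (intro sum_mono norm_le_l1_cart)
      also have "\<dots> \<le> (\<Sum>i\<in>(UNIV::'v set). \<Sum>j\<in>(UNIV::'v set). 1)"
        by (intro sum_mono entry[OF that])
      finally show ?thesis .
    qed
    then show ?thesis unfolding bounded_iff by blast
  qed
  ultimately show ?thesis by (simp add: compact_eq_bounded_closed)
qed

lemma theta_feasible_nonempty:
  assumes "simple_graph E" shows "theta_feasible E \<noteq> {}"
proof -
  let ?X = "(1 / real CARD('a)) *\<^sub>R mat 1 :: real^'a^'a"
  have "?X * adjacency_matrix E = 0"
    using assms by (auto simp: vec_eq_iff mat_def adjacency_matrix_def simple_graph_def)
  moreover have "mat 1 \<bullet> (mat 1 :: real^'a^'a) = real CARD('a)"
    unfolding trace_inner_eq_inner[symmetric] by (simp add: trace_inner_def trace_I)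
  then have "trace_inner ?X (mat 1) = 1"
    by (simp add: trace_inner_eq_inner)
  moreover have "psd ?X"
    by (simp add: psd_def transpose_scalar scaleR_matrix_vector_assoc[symmetric])
  ultimately show ?thesis by (auto simp: theta_feasible_def)
qed

lemma lovasz_theta_attained:
  assumes "simple_graph E"
  obtains X where "X \<in> theta_feasible E" "lovasz_theta E = trace_inner X all_ones"
    "\<And>Y. Y \<in> theta_feasible E \<Longrightarrow> trace_inner Y all_ones \<le> trace_inner X all_ones"
proof -
  have "continuous_on (theta_feasible E) (\<lambda>X. trace_inner X all_ones)"
    unfolding trace_inner_eq_inner by (intro continuous_intros)
  from continuous_attains_sup[OF compact_theta_feasible theta_feasible_nonempty[OF assms] this]
  obtain X where X: "X \<in> theta_feasible E"
    "\<And>Y. Y \<in> theta_feasible E \<Longrightarrow> trace_inner Y all_ones \<le> trace_inner X all_ones"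
    by blast
  then have "lovasz_theta E = trace_inner X all_ones"
    unfolding lovasz_theta_def by (intro cSup_eq_maximum) auto
  with X show thesis using that by blast
qed

lemma psd_degree_matrix: "psd (degree_matrix E)"
proof -
  have "degree_matrix E *v x = (\<chi> i. real (vertex_degree E i) * x $ i)" for x
    by (simp add: degree_matrix_def matrix_vector_mult_def vec_eq_iff if_distrib cong: if_cong)
      (simp add: if_distribR if_distrib[of "\<lambda>c. c * _"] cong: if_cong)
  then have "0 \<le> x \<bullet> (degree_matrix E *v x)" for x
    by (simp add: inner_vec_def mult.left_commute[of "x $ _" "real _"] sum_nonneg)
  then show ?thesis
    by (auto simp: psd_def transpose_def degree_matrix_def vec_eq_iff)
qed

lemma alpha0_attained:
  shows "0 \<le> alpha0 E" "psd (A_alpha E (alpha0 E))"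
    and "0 \<le> \<alpha> \<Longrightarrow> psd (A_alpha E \<alpha>) \<Longrightarrow> alpha0 E \<le> \<alpha>"
proof -
  let ?S = "{\<alpha>. 0 \<le> \<alpha> \<and> psd (A_alpha E \<alpha>)}"
  have "1 \<in> ?S"
    using psd_degree_matrix by (simp add: A_alpha_def)
  then have ne: "?S \<noteq> {}" by blast
  have bdd: "bdd_below ?S" by (auto intro: bdd_belowI[of _ 0])
  have "isCont (A_alpha E) \<alpha>" for \<alpha>
    unfolding A_alpha_def by (intro continuous_intros)
  then have "closed (A_alpha E -` {M. psd M})"
    by (intro continuous_closed_vimage closed_psd)
  moreover have "?S = {0..} \<inter> A_alpha E -` {M. psd M}" by auto
  ultimately have "closed ?S" by (simp only: closed_Int closed_atLeast)
  from closed_contains_Inf[OF ne bdd this]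
  show "0 \<le> alpha0 E" "psd (A_alpha E (alpha0 E))"
    by (auto simp: alpha0_def)
  show "alpha0 E \<le> \<alpha>" if "0 \<le> \<alpha>" "psd (A_alpha E \<alpha>)"
    unfolding alpha0_def using that bdd by (intro cInf_lower) auto
qed

end

theory Submission
  imports Defs
begin

text \<open>
  Every positive semidefinite matrix \<open>M\<close> that vanishes on the edges of a graph \<open>H\<close> satisfies
  \<open>\<langle>M, J\<rangle> \<le> \<vartheta>(H) tr M\<close>, by scaling \<open>M\<close> to trace one. For \<open>H\<close> the complement of \<open>G\<close> this applies to
  \<open>M = A\<^sub>\<alpha> - \<lambda> I\<close> as soon as it is positive semidefinite; there \<open>\<langle>M, J\<rangle> = 2m - n \<lambda>\<close> and
  \<open>tr M = 2m \<alpha> - n \<lambda>\<close>. The two bounds are the cases \<open>\<lambda> = \<lambda>\<^sub>m\<^sub>i\<^sub>n(A\<^sub>\<alpha>)\<close> and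
  \<open>\<lambda> = 0\<close>, \<open>\<alpha> = \<alpha>\<^sub>0\<close>.
\<close>

section \<open>Spectra of symmetric matrices and the smallest eigenvalue\<close>

lemma symmetric_inner_commute:
  fixes M :: "real^'n^'n"
  assumes "transpose M = M"
  shows "x \<bullet> (M *v y) = y \<bullet> (M *v x)"
  using assms by (metis dot_lmul_matrix inner_commute transpose_matrix_vector)

text \<open>Eigenvectors for distinct eigenvalues are orthogonal, and a pairwise orthogonal set in
  finite dimension is finite. This makes the \<open>Min\<close> in \<open>lambda_min\<close> a
  genuine lower bound of the spectrum.\<close>

lemma finite_eigenvalues:
  fixes M :: "real^'n^'n"
  assumes "transpose M = M"
  shows "finite {c. eigenvalue M c}"
proof -
  have "\<forall>c. \<exists>x. eigenvalue M c \<longrightarrow> x \<noteq> 0 \<and> M *v x = c *\<^sub>R x"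
    unfolding eigenvalue_def by blast
  then obtain f where f: "\<And>c. eigenvalue M c \<Longrightarrow> f c \<noteq> 0 \<and> M *v f c = c *\<^sub>R f c"
    using choice[of "\<lambda>c x. eigenvalue M c \<longrightarrow> x \<noteq> 0 \<and> M *v x = c *\<^sub>R x"] by blast
  have orth: "f c \<bullet> f d = 0" if "eigenvalue M c" "eigenvalue M d" "c \<noteq> d" for c d
    using symmetric_inner_commute[OF assms, of "f c" "f d"] f that
    by (simp add: inner_commute)
  then have inj: "inj_on f {c. eigenvalue M c}"
    using f by (intro inj_onI) (metis inner_eq_zero_iff mem_Collect_eq)
  have "pairwise orthogonal (f ` {c. eigenvalue M c})"
    unfolding pairwise_def orthogonal_def using orth by auto
  then have "finite (f ` {c. eigenvalue M c})"
    by (rule pairwise_orthogonal_imp_finite)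
  then show ?thesis
    using inj by (rule finite_imageD)
qed

text \<open>The quadratic form has gradient \<open>2 *\<^sub>R (M *v x)\<close> at \<open>x\<close>.
  If this were nonzero, a short step from \<open>x\<close> against it would take the form from zero
  to a negative value.\<close>

lemma psd_kernel:
  fixes M :: "real^'n^'n"
  assumes "psd M" and "x \<bullet> (M *v x) = 0"
  shows "M *v x = 0"
proof (rule ccontr)
  let ?y = "M *v x"
  let ?b = "?y \<bullet> ?y" and ?c = "?y \<bullet> (M *v ?y)"
  assume "?y \<noteq> 0"
  then have b: "?b > 0" by simp
  have c: "?c \<ge> 0" using assms by (simp add: psd_def)
  have sym: "x \<bullet> (M *v ?y) = ?b"
    using assms(1) by (intro symmetric_inner_commute) (simp add: psd_def)
  \<comment> \<open>A step length with \<open>t * ?c \<le> ?b < 2 * ?b\<close>; adding 1 keeps the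
    denominator positive when \<open>?c = 0\<close>.\<close>
  define t where "t = ?b / (?c + 1)"
  have t: "t > 0" using b c by (simp add: t_def)
  have "0 \<le> (x - t *\<^sub>R ?y) \<bullet> (M *v (x - t *\<^sub>R ?y))"
    using assms by (simp add: psd_def)
  also have "\<dots> = t * (t * ?c - 2 * ?b)"
    using assms(2) sym
    by (simp add: matrix_vector_mult_diff_distrib matrix_vector_mult_scaleR inner_diff_left
        inner_diff_right algebra_simps)
  finally have "2 * ?b \<le> t * ?c"
    using t by (simp add: zero_le_mult_iff)
  also have "\<dots> \<le> ?b"
    using b c by (simp add: t_def divide_simps mult_left_mono)
  finally show False using b by simp
qed

text \<open>By compactness the quadratic form attains a minimum \<mu> on the unit sphere. The shift
  by \<mu> is positive semidefinite, \<mu> is an eigenvalue, and a shift by the smaller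
  \<open>lambda_min M\<close> stays positive semidefinite.\<close>

lemma lambda_min_psd:
  fixes M :: "real^'n^'n"
  assumes sym: "transpose M = M"
  shows "psd (M - lambda_min M *\<^sub>R mat 1)"
proof -
  have tr: "transpose (M - c *\<^sub>R mat 1) = M - c *\<^sub>R mat 1" for c
    using sym by (auto simp: transpose_def vec_eq_iff mat_def)
  have mv: "(M - c *\<^sub>R mat 1) *v x = M *v x - c *\<^sub>R x" for c x
    by (simp add: matrix_vector_mult_diff_rdistrib scaleR_matrix_vector_assoc[symmetric])
  have "continuous_on (sphere 0 1) (\<lambda>x. x \<bullet> (M *v x))"
    by (intro continuous_intros linear_continuous_on matrix_vector_mul_bounded_linear)
  moreover have "sphere 0 1 \<noteq> ({} :: (real^'n) set)" by simp
  ultimately obtain x0 :: "real^'n" where x0: "norm x0 = 1"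
    and min: "\<And>x. norm x = 1 \<Longrightarrow> x0 \<bullet> (M *v x0) \<le> x \<bullet> (M *v x)"
    using continuous_attains_inf[OF compact_sphere, of 0 1 "\<lambda>x. x \<bullet> (M *v x)"]
    by (auto simp: dist_norm)
  define \<mu> where "\<mu> = x0 \<bullet> (M *v x0)"
  have ray: "\<mu> * (x \<bullet> x) \<le> x \<bullet> (M *v x)" for x
  proof (cases "x = 0")
    case False
    have "\<mu> \<le> (x /\<^sub>R norm x) \<bullet> (M *v (x /\<^sub>R norm x))"
      unfolding \<mu>_def using False by (intro min) simp
    also have "\<dots> = (x \<bullet> (M *v x)) / (x \<bullet> x)"
      by (simp add: matrix_vector_mult_scaleR dot_square_norm power2_eq_square divide_simps)
    finally show ?thesis
      using False by (simp add: pos_le_divide_eq)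
  qed simp
  have "psd (M - \<mu> *\<^sub>R mat 1)"
    unfolding psd_def mv using tr ray by (simp add: inner_diff_right)
  moreover have "x0 \<bullet> ((M - \<mu> *\<^sub>R mat 1) *v x0) = 0"
    unfolding mv using x0 by (simp add: inner_diff_right \<mu>_def dot_square_norm)
  \<comment> \<open>The minimiser is a zero of the shifted form, so it lies in the kernel of the
    shifted matrix.\<close>
  ultimately have "M *v x0 = \<mu> *\<^sub>R x0"
    using psd_kernel mv by fastforce
  then have "eigenvalue M \<mu>"
    unfolding eigenvalue_def using x0 by (intro exI[of _ x0]) auto
  then have "lambda_min M \<le> \<mu>"
    unfolding lambda_min_def using finite_eigenvalues[OF sym] by (intro Min_le) auto
  then have "lambda_min M * (x \<bullet> x) \<le> x \<bullet> (M *v x)" for x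
    using ray[of x] mult_right_mono[of "lambda_min M" \<mu> "x \<bullet> x"] by simp
  then show ?thesis
    unfolding psd_def mv using tr by (simp add: inner_diff_right)
qed

section \<open>The theta number as a bound on entry sums\<close>

lemma trace_inner_mat_1: "trace_inner M (mat 1) = trace M"
  by (simp add: trace_inner_def trace_def transpose_def)

lemma trace_inner_all_ones: "trace_inner M all_ones = (\<Sum>i\<in>UNIV. \<Sum>j\<in>UNIV. M $ i $ j)"
  by (simp add: trace_inner_eq_inner inner_vec_def all_ones_def)

lemma psd_scaleR:
  assumes "psd M" and "0 \<le> c"
  shows "psd (c *\<^sub>R M)"
  using assms by (simp add: psd_def transpose_scalar scaleR_matrix_vector_assoc[symmetric])

lemma lovasz_theta_upper:
  assumes "simple_graph E" and "X \<in> theta_feasible E"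
  shows "trace_inner X all_ones \<le> lovasz_theta E"
  using lovasz_theta_attained[OF assms(1)] assms(2) by metis

lemma trace_inner_all_ones_le_lovasz_theta:
  assumes "simple_graph E" and M: "psd M" and supp: "M * adjacency_matrix E = 0"
  shows "trace_inner M all_ones \<le> lovasz_theta E * trace M"
proof (cases "trace M = 0")
  \<comment> \<open>Scaling to trace one is impossible here, but a zero diagonal forces
    \<open>M = 0\<close> and both sides vanish.\<close>
  case True
  then have "M $ i $ i = 0" for i
    using psd_diag_nonneg[OF M] by (simp add: trace_def sum_nonneg_eq_0_iff)
  then have "M $ i $ j = 0" for i j
    using psd_entry_bound[OF M, of i j] by simp
  then show ?thesis
    using True by (simp add: trace_inner_all_ones)
next
  case False
  moreover have "0 \<le> trace M"
    unfolding trace_def using psd_diag_nonneg[OF M] by (simp add: sum_nonneg)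
  ultimately have pos: "0 < trace M" by simp
  let ?X = "(1 / trace M) *\<^sub>R M"
  have "?X \<in> theta_feasible E"
    using pos M supp psd_scaleR[OF M, of "1 / trace M"]
    by (auto simp: theta_feasible_def trace_inner_eq_inner trace_inner_mat_1
        simp flip: trace_inner_mat_1)
  then have "trace_inner ?X all_ones \<le> lovasz_theta E"
    by (rule lovasz_theta_upper[OF assms(1)])
  then show ?thesis
    using pos by (simp add: trace_inner_eq_inner pos_divide_le_eq)
qed

lemma simple_graph_complement: "simple_graph (complement_graph E)"
  by (simp add: simple_graph_def complement_graph_def)

lemma supported_on_complement:
  assumes "\<And>i j. i \<noteq> j \<Longrightarrow> {i, j} \<notin> E \<Longrightarrow> M $ i $ j = 0"
  shows "M * adjacency_matrix (complement_graph E) = 0"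
  using assms by (auto simp: vec_eq_iff adjacency_matrix_def complement_graph_def card_2_iff
      doubleton_eq_iff)

text \<open>An edge gives a rank-one test matrix with entry sum 4 and trace 2. The bound makes the
  later divisions by the theta number and by the theta number minus 1 legitimate.\<close>

lemma lovasz_theta_complement_ge_2:
  fixes E :: "'v::finite set set"
  assumes "simple_graph E" and "E \<noteq> {}"
  shows "2 \<le> lovasz_theta (complement_graph E)"
proof -
  obtain u v where uv: "{u, v} \<in> E" "u \<noteq> v"
    using assms by (fastforce simp: simple_graph_def card_2_iff)
  \<comment> \<open>\<open>M\<close> is the outer square of the indicator of an edge; its only
    nonzero off-diagonal entries sit on that edge, hence off the complement.\<close>
  define w :: "real^'v" where "w = (\<chi> i. if i \<in> {u, v} then 1 else 0)"
  define M :: "real^'v^'v" where "M = (\<chi> i j. w $ i * w $ j)"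
  have "M *v x = (w \<bullet> x) *\<^sub>R w" for x
    by (simp add: vec_eq_iff M_def matrix_vector_mult_def inner_vec_def sum_distrib_left
        mult_ac)
  then have "x \<bullet> (M *v x) = (w \<bullet> x)\<^sup>2" for x
    by (simp add: inner_commute power2_eq_square)
  moreover have "transpose M = M"
    by (simp add: M_def transpose_def vec_eq_iff)
  ultimately have "psd M"
    by (simp add: psd_def)
  moreover have "M * adjacency_matrix (complement_graph E) = 0"
    by (rule supported_on_complement)
      (use uv in \<open>auto simp: M_def w_def insert_commute\<close>)
  ultimately have "trace_inner M all_ones \<le> lovasz_theta (complement_graph E) * trace M"
    by (rule trace_inner_all_ones_le_lovasz_theta[OF simple_graph_complement])
  moreover have "{i. i = u \<or> i = v} = {u, v}" by auto
  then have w: "(\<Sum>i\<in>UNIV. w $ i) = 2"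
    using uv by (simp add: w_def flip: sum.inter_filter)
  then have "trace_inner M all_ones = 4"
    by (simp add: trace_inner_all_ones M_def flip: sum_distrib_left sum_distrib_right)
  moreover have "trace M = (\<Sum>i\<in>UNIV. w $ i)"
    unfolding trace_def by (intro sum.cong) (auto simp: M_def w_def)
  ultimately show ?thesis using w by simp
qed

section \<open>Degree counts, and trace and entry sum of the shifted matrix\<close>

lemma sum_vertex_degree:
  fixes E :: "'v::finite set set"
  assumes "simple_graph E"
  shows "(\<Sum>v\<in>UNIV. vertex_degree E v) = 2 * card E"
  unfolding vertex_degree_def
  by (rule sum_multicount) (use assms in \<open>auto simp: simple_graph_def\<close>)

lemma sum_adjacency_row:
  fixes E :: "'v::finite set set"
  assumes "simple_graph E"
  shows "(\<Sum>j\<in>UNIV. adjacency_matrix E $ i $ j) = real (vertex_degree E i)"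
proof -
  have "e \<in> (\<lambda>j. {i, j}) ` {j. {i, j} \<in> E}" if "e \<in> E" "i \<in> e" for e
  proof -
    have "card e = 2" using assms that by (simp add: simple_graph_def)
    then obtain a b where "e = {a, b}" by (auto simp: card_2_iff)
    \<comment> \<open>The conditional picks the other end of the edge, so neighbours of
      \<open>i\<close> correspond to edges at \<open>i\<close>.\<close>
    then have "e = {i, if i = a then b else a}" using that by auto
    then show ?thesis using that by blast
  qed
  then have "{e \<in> E. i \<in> e} = (\<lambda>j. {i, j}) ` {j. {i, j} \<in> E}"
    by blast
  moreover have "inj_on (\<lambda>j. {i, j}) A" for A
    by (auto simp: inj_on_def doubleton_eq_iff)
  ultimately have "card {j. {i, j} \<in> E} = vertex_degree E i"
    unfolding vertex_degree_def by (simp add: card_image)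
  then show ?thesis
    by (simp add: adjacency_matrix_def flip: sum.inter_filter)
qed

text \<open>The trace depends on \<alpha> because the adjacency matrix has zero diagonal. The entry
  sum does not, since both matrices have the degrees as row sums. Comparing the two yields the
  bound.\<close>

lemma A_alpha_shift_bound:
  fixes E :: "'v::finite set set"
  assumes E: "simple_graph E" and psd: "psd (A_alpha E \<alpha> - c *\<^sub>R mat 1)"
  shows "2 * real (card E) - real CARD('v) * c
    \<le> lovasz_theta (complement_graph E) * (2 * real (card E) * \<alpha> - real CARD('v) * c)"
proof -
  let ?M = "A_alpha E \<alpha> - c *\<^sub>R mat 1"
  have deg: "(\<Sum>i\<in>UNIV. real (vertex_degree E i)) = 2 * real (card E)"
    using sum_vertex_degree[OF E] by (simp flip: of_nat_sum)
  have "{i} \<notin> E" for i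
    using E by (auto simp: simple_graph_def)
  then have "trace ?M = (\<Sum>i\<in>UNIV. \<alpha> * real (vertex_degree E i) - c)"
    by (simp add: trace_def A_alpha_def degree_matrix_def adjacency_matrix_def mat_def)
  also have "\<dots> = 2 * real (card E) * \<alpha> - real CARD('v) * c"
    by (simp add: sum_subtractf deg flip: sum_distrib_left)
  finally have tr: "trace ?M = 2 * real (card E) * \<alpha> - real CARD('v) * c" .
  have row: "(\<Sum>j\<in>UNIV. ?M $ i $ j) = real (vertex_degree E i) - c" for i
  proof -
    have "(\<Sum>j\<in>UNIV. ?M $ i $ j) = \<alpha> * (\<Sum>j\<in>UNIV. degree_matrix E $ i $ j)
        + (1 - \<alpha>) * (\<Sum>j\<in>UNIV. adjacency_matrix E $ i $ j)
        - c * (\<Sum>j\<in>UNIV. (mat 1 :: real^'v^'v) $ i $ j)"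
      by (simp add: A_alpha_def sum_subtractf sum.distrib sum_distrib_left)
    then show ?thesis
      using sum_adjacency_row[OF E, of i]
      by (simp add: degree_matrix_def mat_def algebra_simps)
  qed
  have "trace_inner ?M all_ones = 2 * real (card E) - real CARD('v) * c"
    unfolding trace_inner_all_ones row by (simp add: sum_subtractf deg)
  moreover have "?M * adjacency_matrix (complement_graph E) = 0"
    by (rule supported_on_complement)
      (simp add: A_alpha_def degree_matrix_def adjacency_matrix_def mat_def)
  then have "trace_inner ?M all_ones \<le> lovasz_theta (complement_graph E) * trace ?M"
    by (rule trace_inner_all_ones_le_lovasz_theta[OF simple_graph_complement psd])
  ultimately show ?thesis using tr by simp
qed

lemma transpose_A_alpha: "transpose (A_alpha E \<alpha>) = A_alpha E \<alpha>"
  by (auto simp: vec_eq_iff transpose_def A_alpha_def degree_matrix_def adjacency_matrix_def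
      insert_commute)

theorem theorem3:
  fixes E :: "'v::finite set set"
  assumes "simple_graph E"
    and "card E > 0"
  shows "(\<forall>\<alpha>\<in>{0..1}.
            lambda_min (A_alpha E \<alpha>)
              \<le> 2 * real (card E) / real CARD('v)
                * ((lovasz_theta (complement_graph E) * \<alpha> - 1)
                   / (lovasz_theta (complement_graph E) - 1)))
         \<and> alpha0 E \<ge> 1 / lovasz_theta (complement_graph E)"
proof -
  define t where "t = lovasz_theta (complement_graph E)"
  define m where "m = real (card E)"
  define n where "n = real CARD('v)"
  have pos: "m > 0" "n > 0" using assms by (simp_all add: m_def n_def)
  have t: "t \<ge> 2"
    unfolding t_def using assms by (intro lovasz_theta_complement_ge_2) auto
  have "lambda_min (A_alpha E \<alpha>) \<le> 2 * m / n * ((t * \<alpha> - 1) / (t - 1))" for \<alpha>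
  proof -
    let ?l = "lambda_min (A_alpha E \<alpha>)"
    have "2 * m - n * ?l \<le> t * (2 * m * \<alpha> - n * ?l)"
      unfolding m_def n_def t_def
      by (intro A_alpha_shift_bound assms lambda_min_psd transpose_A_alpha)
    then have "?l * (n * (t - 1)) \<le> 2 * m * (t * \<alpha> - 1)"
      by (simp add: algebra_simps)
    \<comment> \<open>The divisor is positive because \<open>t \<ge> 2\<close>.\<close>
    then have "?l \<le> 2 * m * (t * \<alpha> - 1) / (n * (t - 1))"
      using pos t by (subst pos_le_divide_eq) simp_all
    then show ?thesis by simp
  qed
  moreover have "1 / t \<le> alpha0 E"
  proof -
    \<comment> \<open>The infimum defining \<open>alpha0\<close> is attained, so the unshifted
      matrix at \<open>alpha0 E\<close> is itself positive semidefinite.\<close>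
    have "2 * m - n * 0 \<le> t * (2 * m * alpha0 E - n * 0)"
      unfolding m_def n_def t_def
      by (intro A_alpha_shift_bound assms) (simp add: alpha0_attained)
    then have "(2 * m) * 1 \<le> (2 * m) * (t * alpha0 E)"
      by (simp add: mult_ac)
    then have "1 \<le> t * alpha0 E"
      using pos mult_le_cancel_left_pos[of "2 * m" 1 "t * alpha0 E"] by simp
    then show ?thesis
      using t by (simp add: pos_divide_le_eq mult.commute)
  qed
  ultimately show ?thesis
    unfolding t_def m_def n_def by blast
qed

end
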